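(* Let $G$ be a point lying strictly inside (in the interior of) the hyperbolicity domain $\Pi\subset{\bf R}^n$. Suppose that at $G$ there hold exactly $s$ equalities of the form $x_j^{(k_i)}=x_i$, with $s$ different indices $i$ and $s$ different couples $(k_i,j)$. Then in a neighbourhood of the point $G$ these $s$ equalities define $s$ smooth hypersurfaces of ${\bf R}^n$ intersecting transversally at $G$.
   Context: A real monic polynomial in one real variable is called hyperbolic (resp. strictly hyperbolic) if all its roots are real (resp. real and distinct). For $a=(a_1,\ldots,a_n)\in{\bf R}^n$ set $P(x,a)=x^n+a_1x^{n-1}+\ldots+a_n$; the hyperbolicity domain is $\Pi=\{a\in{\bf R}^n\mid P(\cdot,a)\text{ is hyperbolic}\}$. Points strictly inside $\Pi$ are those for which $P$ is strictly hyperbolic. For $a\in\Pi$, $x_1\leq\ldots\leq x_n$ denote the roots of $P$, and for $1\leq k\leq n-1$, $x^{(k)}_1\leq\ldots\leq x^{(k)}_{n-k}$ denote the roots of the $k$-th derivative $P^{(k)}$ (with respect to $x$), which are all real. In the equalities $x_j^{(k_i)}=x_i$ the orders $k_i\in\{1,\ldots,n-1\}$ of the derivatives may differ from one equality to another. Near a point strictly inside $\Pi$ all the $x_i$ and $x_j^{(k)}$ are smooth functions of $a$, and each equality is regarded as an equation on $a\in{\bf R}^n$ near $G$. Smooth hypersurfaces through $G$ intersect transversally at $G$ if their normal vectors (differentials of local defining equations) at $G$ are linearly independent. *)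

theory Defs
  imports "HOL-Analysis.Analysis"
begin

text \<open>
  The coordinates of \<^typ>\<open>real ^ 'n\<close> carry no canonical order, so the labelling
  \<open>idx\<close>, a bijection from \<open>{1..CARD('n)}\<close> onto \<open>'n\<close>, says which coordinate
  is \<open>a\<^sub>1\<close>, which is \<open>a\<^sub>2\<close>, and so on. All indices start at 1.
\<close>

definition monic_poly :: "(nat \<Rightarrow> 'n) \<Rightarrow> real ^ 'n \<Rightarrow> real poly" where
  "monic_poly idx a =
     monom 1 CARD('n) + (\<Sum>l = 1..CARD('n). monom (a $ idx l) (CARD('n) - l))"

definition hyperbolic :: "real poly \<Rightarrow> bool" where
  "hyperbolic p \<longleftrightarrow> (\<forall>z :: complex. poly (map_poly of_real p) z = 0 \<longrightarrow> z \<in> \<real>)"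

definition hyperbolicity_domain :: "(nat \<Rightarrow> 'n) \<Rightarrow> (real ^ 'n) set" where
  "hyperbolicity_domain idx = {a. hyperbolic (monic_poly idx a)}"

text \<open>
  The \<open>j\<close>-th real root in nondecreasing order, roots being repeated according to multiplicity;
  meaningful only for \<open>1 \<le> j \<le> size (proots p)\<close>.
\<close>

definition ordered_root :: "real poly \<Rightarrow> nat \<Rightarrow> real" where
  "ordered_root p j = sorted_list_of_multiset (proots p) ! (j - 1)"

text \<open>\<open>x\<^sub>j\<close> for \<open>k = 0\<close> and \<open>x\<^sub>j\<^sup>(\<^sup>k\<^sup>)\<close> for \<open>k \<ge> 1\<close>.\<close>

definition xroot :: "(nat \<Rightarrow> 'n) \<Rightarrow> nat \<Rightarrow> nat \<Rightarrow> real ^ 'n \<Rightarrow> real" where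
  "xroot idx k j a = ordered_root ((pderiv ^^ k) (monic_poly idx a)) j"

text \<open>The triple \<open>(i, k, j)\<close> stands for the equality of \<open>x\<^sub>j\<^sup>(\<^sup>k\<^sup>)\<close> and \<open>x\<^sub>i\<close>.\<close>

definition equality_fun :: "(nat \<Rightarrow> 'n) \<Rightarrow> nat \<times> nat \<times> nat \<Rightarrow> real ^ 'n \<Rightarrow> real" where
  "equality_fun idx = (\<lambda>(i, k, j) a. xroot idx k j a - xroot idx 0 i a)"

definition equalities_at :: "(nat \<Rightarrow> 'n) \<Rightarrow> real ^ 'n \<Rightarrow> (nat \<times> nat \<times> nat) set" where
  "equalities_at idx a =
     {(i, k, j). i \<in> {1..CARD('n)} \<and> k \<in> {1..CARD('n) - 1} \<and> j \<in> {1..CARD('n) - k} \<and>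
                 xroot idx k j a = xroot idx 0 i a}"

text \<open>
  Iterated continuous differentiability and \<open>C\<^sup>\<infinity>\<close> smoothness; to be used on open sets only.
\<close>

primrec higher_differentiable_on ::
  "'a::real_normed_vector set \<Rightarrow> ('a \<Rightarrow> 'b::real_normed_vector) \<Rightarrow> nat \<Rightarrow> bool" where
  "higher_differentiable_on S f 0 \<longleftrightarrow> continuous_on S f"
| "higher_differentiable_on S f (Suc m) \<longleftrightarrow>
     (\<forall>x\<in>S. f differentiable (at x)) \<and>
     (\<forall>v. higher_differentiable_on S (\<lambda>x. frechet_derivative f (at x) v) m)"

definition smooth_on ::
  "'a::real_normed_vector set \<Rightarrow> ('a \<Rightarrow> 'b::real_normed_vector) \<Rightarrow> bool" where
  "smooth_on S f \<longleftrightarrow> (\<forall>m. higher_differentiable_on S f m)"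

definition defining_equation :: "'a::euclidean_space set \<Rightarrow> ('a \<Rightarrow> real) \<Rightarrow> 'a set \<Rightarrow> bool" where
  "defining_equation U f M \<longleftrightarrow>
     open U \<and> smooth_on U f \<and> M \<inter> U = {x \<in> U. f x = 0} \<and>
     (\<forall>x \<in> M \<inter> U. \<exists>N. N \<noteq> 0 \<and> (GDERIV f x :> N))"

definition smooth_hypersurface :: "'a::euclidean_space set \<Rightarrow> bool" where
  "smooth_hypersurface M \<longleftrightarrow> (\<forall>p\<in>M. \<exists>U f. p \<in> U \<and> defining_equation U f M)"

text \<open>
  A normal vector at \<open>p\<close> is unique up to a nonzero factor, so it does not matter which
  local defining equations are chosen. Independence is that of the family \<open>N\<close>, whence \<open>inj_on\<close>.
\<close>

definition intersect_transversally_at ::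
  "'a::euclidean_space \<Rightarrow> 'i set \<Rightarrow> ('i \<Rightarrow> 'a set) \<Rightarrow> bool" where
  "intersect_transversally_at p I M \<longleftrightarrow>
     (\<exists>U f N. p \<in> U \<and>
        (\<forall>e\<in>I. p \<in> M e \<and> defining_equation U (f e) (M e) \<and> (GDERIV (f e) p :> N e)) \<and>
        inj_on N I \<and> independent (N ` I))"

end

theory Submission
  imports Defs "HOL-Computational_Algebra.Fundamental_Theorem_Algebra"
begin

text \<open>
  Move the polynomial \<open>P\<close> in a direction \<open>V\<close>, a polynomial of degree less than \<open>n\<close>. A simple root
  \<open>\<xi>\<close> of \<open>P\<^sup>(\<^sup>k\<^sup>)\<close> then has velocity \<open>- V\<^sup>(\<^sup>k\<^sup>)(\<xi>) / P\<^sup>(\<^sup>k\<^sup>+\<^sup>1\<^sup>)(\<xi>)\<close>. Take for \<open>V\<close> the directions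
  \<open>- Q\<^sub>m\<close> with \<open>P = (x - x\<^sub>m) Q\<^sub>m\<close>. In direction \<open>m\<close> the root \<open>x\<^sub>m\<close> has velocity 1 and the other roots
  of \<open>P\<close> have velocity 0, so these directions are those of the coordinates \<open>x\<^sub>1, \<dots>, x\<^sub>n\<close>. The velocities
  \<open>C\<^sub>m\<close> of a root of \<open>P\<^sup>(\<^sup>k\<^sup>)\<close>, \<open>1 \<le> k < n\<close>, are all positive (\<open>velocity_higher_pderiv_pos\<close>), and they
  add up to 1, because the sum of the \<open>Q\<^sub>m\<close> is \<open>P'\<close>.

  Consequently the differentials of the functions \<open>x\<^sub>j\<^sup>(\<^sup>k\<^sup>) - x\<^sub>i\<close> have, in root coordinates, the rows
  of \<open>C - J\<close>, where \<open>C\<close> is a stochastic matrix with positive entries and \<open>J\<close> has a single 1 in each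
  row, at the position \<open>i\<close>. The indices \<open>i\<close> being distinct, one may restrict to the columns with these
  indices, where \<open>J\<close> becomes the identity. The smallest root \<open>x\<^sub>1\<close> lies strictly below all roots of the
  derivatives, so the index 1 is not among them and the restricted \<open>C\<close> has row sums strictly less
  than 1. Such a matrix does not have the eigenvalue 1, and the differentials are independent
  (\<open>relative_velocities_independent\<close>). For a single equality this says that the differential does not
  vanish, at any point of the hypersurface.

  As neighbourhood serves the whole interior of the hyperbolicity domain. There all roots of \<open>P\<close> are
  real and distinct (\<open>strictly_hyperbolic_interior\<close>), since a double root can be pushed off the real
  axis by an arbitrarily small perturbation. By Rolle's theorem the roots of the derivatives are real
  and distinct as well, and simple roots depend smoothly on the coefficients.
\<close>

section \<open>Closure properties of smooth functions\<close>

lemma higher_differentiable_on_cong: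
  assumes "open S" and "\<And>x. x \<in> S \<Longrightarrow> f x = g x" and "higher_differentiable_on S f m"
  shows "higher_differentiable_on S g m"
  using assms(2,3)
proof (induction m arbitrary: f g)
  case 0
  then show ?case using continuous_on_cong[of S S f g] by simp
next
  case (Suc m)
  have diff: "f differentiable (at x)" if "x \<in> S" for x
    using Suc.prems that by simp
  have same: "frechet_derivative f (at x) = frechet_derivative g (at x)" if "x \<in> S" for x
    using frechet_derivative_transform_within_open[OF diff[OF that] \<open>open S\<close> that] Suc.prems(1) by blast
  have "g differentiable (at x)" if "x \<in> S" for x
    using diff[OF that] has_derivative_transform_within_open[OF _ \<open>open S\<close> that, of f _ UNIV g] Suc.prems(1)
    unfolding differentiable_def by blast
  moreover have "higher_differentiable_on S (\<lambda>x. frechet_derivative g (at x) v) m" for v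
    by (rule Suc.IH[of "\<lambda>x. frechet_derivative f (at x) v"]) (use same Suc.prems in auto)
  ultimately show ?case by simp
qed

text \<open>
  The derivative may be given by any formula valid on \<open>S\<close>, instead of by \<^const>\<open>frechet_derivative\<close>.
\<close>
lemma higher_differentiable_on_SucI:
  assumes "open S" and der: "\<And>x. x \<in> S \<Longrightarrow> (f has_derivative D x) (at x)"
    and "\<And>v. higher_differentiable_on S (\<lambda>x. D x v) m"
  shows "higher_differentiable_on S f (Suc m)"
proof -
  have "higher_differentiable_on S (\<lambda>x. frechet_derivative f (at x) v) m" for v
    by (rule higher_differentiable_on_cong[OF \<open>open S\<close> _ assms(3)[of v]])
      (use frechet_derivative_at[OF der] in simp)
  then show ?thesis using der by (auto simp: differentiable_def)
qed

lemma higher_differentiable_on_SucD: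
  assumes "higher_differentiable_on S f (Suc m)" and "x \<in> S"
  shows "(f has_derivative frechet_derivative f (at x)) (at x)"
  using assms frechet_derivative_works by auto

lemma higher_differentiable_on_decrease:
  "higher_differentiable_on S f (Suc m) \<Longrightarrow> higher_differentiable_on S f m"
proof (induction m arbitrary: f)
  case 0
  then show ?case
    by (auto intro!: continuous_at_imp_continuous_on differentiable_imp_continuous_within)
next
  case (Suc m)
  then show ?case by (metis higher_differentiable_on.simps(2))
qed

lemma higher_differentiable_on_const: "higher_differentiable_on S (\<lambda>x. c) m"
  by (induction m arbitrary: c) auto

lemma higher_differentiable_on_bounded_linear:
  assumes "open S" and "bounded_linear f"
  shows "higher_differentiable_on S f m"
proof (cases m)
  case 0
  then show ?thesis using assms(2) by (simp add: bounded_linear.linear linear_continuous_on)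
next
  case (Suc k)
  have "higher_differentiable_on S f (Suc k)"
    by (rule higher_differentiable_on_SucI[OF assms(1), where D = "\<lambda>_. f"])
      (use assms(2) in \<open>auto intro: bounded_linear_imp_has_derivative higher_differentiable_on_const\<close>)
  with Suc show ?thesis by simp
qed

lemma higher_differentiable_on_add:
  assumes "open S" and "higher_differentiable_on S f m" and "higher_differentiable_on S g m"
  shows "higher_differentiable_on S (\<lambda>x. f x + g x) m"
  using assms(2,3)
proof (induction m arbitrary: f g)
  case 0
  then show ?case by (auto intro: continuous_intros)
next
  case (Suc m)
  show ?case
    by (rule higher_differentiable_on_SucI[OF \<open>open S\<close>
          has_derivative_add[OF higher_differentiable_on_SucD higher_differentiable_on_SucD]])
      (use Suc in auto)
qed

lemma higher_differentiable_on_sum: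
  assumes "open S" and "\<And>i. i \<in> I \<Longrightarrow> higher_differentiable_on S (f i) m"
  shows "higher_differentiable_on S (\<lambda>x. \<Sum>i\<in>I. f i x) m"
  using assms(2)
  by (induction I rule: infinite_finite_induct)
    (auto intro: higher_differentiable_on_const higher_differentiable_on_add[OF \<open>open S\<close>])

lemma higher_differentiable_on_mult:
  fixes f g :: "'a::real_normed_vector \<Rightarrow> real"
  assumes "open S" and "higher_differentiable_on S f m" and "higher_differentiable_on S g m"
  shows "higher_differentiable_on S (\<lambda>x. f x * g x) m"
  using assms(2,3)
proof (induction m arbitrary: f g)
  case 0
  then show ?case by (auto intro: continuous_intros)
next
  case (Suc m)
  note lower = Suc.prems[THEN higher_differentiable_on_decrease]
  show ?case
    by (rule higher_differentiable_on_SucI[OF \<open>open S\<close>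
          has_derivative_mult[OF higher_differentiable_on_SucD higher_differentiable_on_SucD]])
      (use Suc lower in \<open>auto intro!: higher_differentiable_on_add[OF \<open>open S\<close>]\<close>)
qed

text \<open>
  The derivative of \<open>1/f\<close> is a polynomial in \<open>1/f\<close> and the derivative of \<open>f\<close>, so regularity of \<open>1/f\<close>
  propagates from each order to the next.
\<close>
lemma higher_differentiable_on_inverse:
  fixes f :: "'a::real_normed_vector \<Rightarrow> real"
  assumes "open S" and "\<And>x. x \<in> S \<Longrightarrow> f x \<noteq> 0" and "higher_differentiable_on S f m"
  shows "higher_differentiable_on S (\<lambda>x. inverse (f x)) m"
  using assms(3)
proof (induction m)
  case 0
  then show ?case using assms(2) by (auto intro: continuous_intros)
next
  case (Suc m)
  have inv: "higher_differentiable_on S (\<lambda>x. inverse (f x)) m"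
    using Suc higher_differentiable_on_decrease by blast
  show ?case
  proof (rule higher_differentiable_on_SucI[OF \<open>open S\<close>])
    fix x assume "x \<in> S"
    show "((\<lambda>x. inverse (f x)) has_derivative
        (\<lambda>h. - 1 * (inverse (f x) * frechet_derivative f (at x) h * inverse (f x)))) (at x)"
      using Deriv.has_derivative_inverse[OF assms(2)[OF \<open>x \<in> S\<close>]
          higher_differentiable_on_SucD[OF Suc.prems \<open>x \<in> S\<close>]] by simp
  next
    fix v
    show "higher_differentiable_on S
        (\<lambda>x. - 1 * (inverse (f x) * frechet_derivative f (at x) v * inverse (f x))) m"
      using inv Suc.prems
      by (intro higher_differentiable_on_mult[OF \<open>open S\<close>] higher_differentiable_on_const) auto
  qed
qed

lemma higher_differentiable_on_poly:
  fixes f :: "'a::real_normed_vector \<Rightarrow> real"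
  assumes "open S" and "higher_differentiable_on S f m"
  shows "higher_differentiable_on S (\<lambda>x. poly p (f x)) m"
  by (induction p)
    (auto intro!: assms higher_differentiable_on_add higher_differentiable_on_mult higher_differentiable_on_const)

section \<open>Polynomials with real and distinct roots\<close>

definition strictly_hyperbolic :: "real poly \<Rightarrow> bool" where
  "strictly_hyperbolic p \<longleftrightarrow> p \<noteq> 0 \<and> card {x. poly p x = 0} = degree p"

lemma strictly_hyperbolicD:
  assumes "strictly_hyperbolic p"
  shows "p \<noteq> 0" "finite {x. poly p x = 0}" "card {x. poly p x = 0} = degree p"
  using assms by (auto simp: strictly_hyperbolic_def poly_roots_finite)

lemma strictly_hyperbolic_proots:
  assumes "strictly_hyperbolic p"
  shows "proots p = mset_set {x. poly p x = 0}"
proof -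
  note sh = strictly_hyperbolicD[OF assms]
  have "mset_set {x. poly p x = 0} \<subseteq># proots p"
    using sh by (intro mset_subset_eqI) (simp add: count_mset_set' order_root Suc_leI)
  moreover have "size (proots p) \<le> size (mset_set {x. poly p x = 0})"
    using size_proots_le[of p] sh by simp
  ultimately show ?thesis
    by (metis mset_subset_size subset_mset.le_neq_trans not_le)
qed

lemma strictly_hyperbolic_simple_root:
  assumes "strictly_hyperbolic p" and "poly p x = 0"
  shows "poly (pderiv p) x \<noteq> 0"
proof -
  note sh = strictly_hyperbolicD[OF assms(1)]
  have "order a p = (if poly p a = 0 then 1 else 0)" for a
    using strictly_hyperbolic_proots[OF assms(1)] sh count_proots[OF sh(1), of a]
    by (simp add: count_mset_set')
  then have "rsquarefree p" using sh(1) by (simp add: rsquarefree_def)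
  then show ?thesis using assms(2) by (simp add: rsquarefree_roots)
qed

lemma strictly_hyperbolic_ordered_root:
  assumes "strictly_hyperbolic p"
  shows "bij_betw (ordered_root p) {1..degree p} {x. poly p x = 0}"
    and "strict_mono_on {1..degree p} (ordered_root p)"
proof -
  note sh = strictly_hyperbolicD[OF assms]
  define xs where "xs = sorted_list_of_set {x. poly p x = 0}"
  have xs: "set xs = {x. poly p x = 0}" "length xs = degree p" "sorted_wrt (<) xs"
    using sh by (auto simp: xs_def)
  have root: "ordered_root p j = xs ! (j - 1)" for j
    using sh by (simp add: ordered_root_def strictly_hyperbolic_proots[OF assms] xs_def)
  show mono: "strict_mono_on {1..degree p} (ordered_root p)"
    using xs(2,3) by (auto simp: strict_mono_on_def root sorted_wrt_iff_nth_less)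
  have "ordered_root p ` {1..degree p} = set xs"
  proof safe
    fix y assume "y \<in> set xs"
    then obtain i where "i < length xs" "xs ! i = y" by (auto simp: in_set_conv_nth)
    then show "y \<in> ordered_root p ` {1..degree p}"
      using xs(2) by (intro image_eqI[of _ _ "Suc i"]) (auto simp: root)
  qed (use xs(2) in \<open>auto simp: root\<close>)
  then show "bij_betw (ordered_root p) {1..degree p} {x. poly p x = 0}"
    using strict_mono_on_imp_inj_on[OF mono] xs(1) by (simp add: bij_betw_def)
qed

text \<open>
  An increasing family of as many roots as the degree allows exhausts the roots; hence it is
  the enumeration \<^const>\<open>ordered_root\<close>. This identifies roots found by the intermediate value
  theorem or by Rolle's theorem with roots of prescribed number.
\<close>
lemma strictly_hyperbolicI_increasing_roots:
  assumes "p \<noteq> 0" and "strict_mono_on {1..degree p} r"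
    and "\<And>i. i \<in> {1..degree p} \<Longrightarrow> poly p (r i) = 0"
  shows "strictly_hyperbolic p" and "\<And>j. j \<in> {1..degree p} \<Longrightarrow> ordered_root p j = r j"
proof -
  have sub: "r ` {1..degree p} \<subseteq> {x. poly p x = 0}" using assms(3) by auto
  have card: "card (r ` {1..degree p}) = degree p"
    using card_image[OF strict_mono_on_imp_inj_on[OF assms(2)]] by simp
  have roots: "r ` {1..degree p} = {x. poly p x = 0}"
    using card_seteq[OF poly_roots_finite[OF assms(1)] sub] card card_poly_roots_bound[OF assms(1)] by simp
  show sh: "strictly_hyperbolic p"
    using assms(1) card roots by (simp add: strictly_hyperbolic_def)
  define xs where "xs = map (\<lambda>i. r (Suc i)) [0..<degree p]"
  have "sorted_wrt (<) xs"
    using assms(2) by (auto simp: xs_def sorted_wrt_iff_nth_less strict_mono_on_def)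
  moreover have "set xs = {x. poly p x = 0}"
  proof -
    have "set xs = r ` Suc ` {0..<degree p}"
      by (simp only: xs_def set_map set_upt image_image)
    also have "Suc ` {0..<degree p} = {1..degree p}" by (simp add: atLeastLessThanSuc_atLeastAtMost)
    finally show ?thesis by (simp only: roots)
  qed
  ultimately have "sorted_list_of_set {x. poly p x = 0} = xs"
    using sorted_list_of_set_unique[OF strictly_hyperbolicD(2)[OF sh], of xs]
      strictly_hyperbolicD(3)[OF sh] by (simp add: xs_def)
  then show "ordered_root p j = r j" if "j \<in> {1..degree p}" for j
    using that strictly_hyperbolicD(2)[OF sh]
    by (auto simp: ordered_root_def strictly_hyperbolic_proots[OF sh] xs_def)
qed

text \<open>
  By Rolle's theorem the derivative has a root in each gap between consecutive roots, and this
  accounts for all its roots. In particular each of them has a root of \<open>p\<close> to its left.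
\<close>
lemma strictly_hyperbolic_pderiv:
  assumes "strictly_hyperbolic p" and "0 < degree p"
  shows "strictly_hyperbolic (pderiv p)"
    and "\<And>y. poly (pderiv p) y = 0 \<Longrightarrow> \<exists>x<y. poly p x = 0"
proof -
  let ?r = "ordered_root p"
  note ord = strictly_hyperbolic_ordered_root[OF assms(1)]
  have deg: "degree (pderiv p) = degree p - 1" by (rule degree_pderiv)
  have nz: "pderiv p \<noteq> 0" using assms(2) by (simp add: pderiv_eq_0_iff)
  have root: "poly p (?r i) = 0" if "i \<in> {1..degree p}" for i
    using bij_betwE[OF ord(1)] that by auto
  have "\<exists>y. ?r i < y \<and> y < ?r (Suc i) \<and> poly (pderiv p) y = 0" if i: "i \<in> {1..degree p - 1}" for i
  proof -
    have less: "?r i < ?r (Suc i)" by (rule strict_mono_onD[OF ord(2)]) (use i in auto)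
    have roots: "poly p (?r i) = 0" "poly p (?r (Suc i)) = 0" using i by (auto intro!: root)
    obtain z where "?r i < z" "z < ?r (Suc i)"
      and "poly p (?r (Suc i)) - poly p (?r i) = (?r (Suc i) - ?r i) * poly (pderiv p) z"
      using poly_MVT[OF less, of p] by blast
    then show ?thesis using roots less by (intro exI[of _ z]) simp
  qed
  then obtain y where y: "\<And>i. i \<in> {1..degree p - 1} \<Longrightarrow>
      ?r i < y i \<and> y i < ?r (Suc i) \<and> poly (pderiv p) (y i) = 0" by metis
  have mono: "strict_mono_on {1..degree (pderiv p)} y"
  proof (rule strict_mono_onI)
    fix i j assume ij: "i \<in> {1..degree (pderiv p)}" "j \<in> {1..degree (pderiv p)}" "i < j"
    have "?r (Suc i) \<le> ?r j"
    proof (cases "Suc i = j")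
      case False
      then have "?r (Suc i) < ?r j" using ij deg by (intro strict_mono_onD[OF ord(2)]) auto
      then show ?thesis by simp
    qed simp
    moreover have "y i < ?r (Suc i)" "?r j < y j" using y[of i] y[of j] ij deg by simp_all
    ultimately show "y i < y j" by linarith
  qed
  show sh: "strictly_hyperbolic (pderiv p)"
    by (rule strictly_hyperbolicI_increasing_roots(1)[OF nz mono]) (use y deg in auto)
  have all: "ordered_root (pderiv p) i = y i" if "i \<in> {1..degree (pderiv p)}" for i
    by (rule strictly_hyperbolicI_increasing_roots(2)[OF nz mono _ that]) (use y deg in auto)
  show "\<exists>x<z. poly p x = 0" if "poly (pderiv p) z = 0" for z
  proof -
    have "z \<in> ordered_root (pderiv p) ` {1..degree (pderiv p)}"
      using that by (simp only: bij_betw_imp_surj_on[OF strictly_hyperbolic_ordered_root(1)[OF sh]] mem_Collect_eq)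
    then obtain i where i: "i \<in> {1..degree (pderiv p)}" "z = ordered_root (pderiv p) i" by (rule imageE)
    have "?r i < z" using y[of i] all[of i] deg i by simp
    moreover have "poly p (?r i) = 0" by (rule root) (use i deg in auto)
    ultimately show ?thesis by blast
  qed
qed

lemma strictly_hyperbolic_higher_pderiv:
  assumes "strictly_hyperbolic p" and "k \<le> degree p"
  shows "strictly_hyperbolic ((pderiv ^^ k) p)"
  using assms(2)
proof (induction k)
  case (Suc k)
  then show ?case using strictly_hyperbolic_pderiv(1)[of "(pderiv ^^ k) p"]
    by (simp add: degree_higher_pderiv)
qed (simp add: assms(1))

lemma root_below_higher_pderiv_root:
  assumes "strictly_hyperbolic p" and "0 < k" "k \<le> degree p" and "poly ((pderiv ^^ k) p) y = 0"
  shows "\<exists>x<y. poly p x = 0"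
  using assms(2-4)
proof (induction k arbitrary: y)
  case (Suc k)
  obtain x where x: "x < y" "poly ((pderiv ^^ k) p) x = 0"
    using strictly_hyperbolic_pderiv(2)[OF strictly_hyperbolic_higher_pderiv[OF assms(1), of k]] Suc.prems
    by (auto simp: degree_higher_pderiv)
  show ?case
  proof (cases "k = 0")
    case False
    then obtain z where "z < x" "poly p z = 0" using Suc.IH[of x] x Suc.prems by auto
    then show ?thesis using x(1) by (meson less_trans)
  qed (use x in auto)
qed simp

section \<open>Velocities of the roots of derivatives\<close>

text \<open>
  Lagrange interpolation at the roots \<open>x\<close> of \<open>p\<close>: the cofactor \<open>p / (X - x)\<close> vanishes at the other
  roots and takes the value \<open>p'(x)\<close> at \<open>x\<close>. The coefficients \<open>Q(x) / p'(x)\<close> are the velocities of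
  the roots when \<open>p\<close> moves in direction \<open>- Q\<close>.
\<close>
lemma lagrange_cofactors:
  assumes "strictly_hyperbolic p"
  obtains q where "\<And>x. poly p x = 0 \<Longrightarrow> p = [:-x, 1:] * q x"
    and "\<And>Q. degree Q < degree p \<Longrightarrow>
           Q = (\<Sum>x | poly p x = 0. smult (poly Q x / poly (pderiv p) x) (q x))"
proof
  define q where "q x = p div [:-x, 1:]" for x
  note sh = strictly_hyperbolicD[OF assms]
  show fac: "p = [:-x, 1:] * q x" if "poly p x = 0" for x
    using that dvd_mult_div_cancel unfolding q_def poly_eq_0_iff_dvd by metis
  have deg: "degree (q x) < degree p" if "poly p x = 0" for x
  proof -
    have "q x \<noteq> 0" using fac[OF that] sh(1) by auto
    then have "degree p = Suc (degree (q x))" by (subst fac[OF that], subst degree_mult_eq) auto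
    then show ?thesis by simp
  qed
  have diag: "poly (q x) x = poly (pderiv p) x" if "poly p x = 0" for x
    using arg_cong[OF fac[OF that], of "\<lambda>p. poly (pderiv p) x"]
    by (simp only: pderiv_mult) (simp add: pderiv_pCons)
  have off: "poly (q x) y = 0" if "poly p x = 0" "poly p y = 0" "x \<noteq> y" for x y
    using that(2,3) by (subst (asm) fac[OF that(1)]) auto
  show "Q = (\<Sum>x | poly p x = 0. smult (poly Q x / poly (pderiv p) x) (q x))" if Q: "degree Q < degree p" for Q
  proof (rule poly_eqI_degree[where A = "{x. poly p x = 0}"])
    fix y assume y: "y \<in> {x. poly p x = 0}"
    have "(\<Sum>x | poly p x = 0. poly Q x / poly (pderiv p) x * poly (q x) y)
        = (\<Sum>x | poly p x = 0. if x = y then poly Q y else 0)"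
      using y off diag strictly_hyperbolic_simple_root[OF assms] by (intro sum.cong) auto
    then show "poly Q y = poly (\<Sum>x | poly p x = 0. smult (poly Q x / poly (pderiv p) x) (q x)) y"
      using y sh(2) by (simp add: poly_sum)
  next
    have "degree (\<Sum>x | poly p x = 0. smult (poly Q x / poly (pderiv p) x) (q x)) < degree p"
      using Q deg by (intro degree_sum_less) (auto intro: le_less_trans[OF degree_smult_le])
    then show "degree (\<Sum>x | poly p x = 0. smult (poly Q x / poly (pderiv p) x) (q x)) < card {x. poly p x = 0}"
      using sh(3) by simp
  qed (use Q sh in simp)
qed

text \<open>
  Let \<open>\<lambda>\<^sub>x = Q(x) / p'(x)\<close>. Differentiating \<open>p = (X - x) q\<^sub>x\<close> at a root \<open>\<eta>\<close> of \<open>p'\<close> gives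
  \<open>q\<^sub>x'(\<eta>) = - p(\<eta>) / (\<eta> - x)\<^sup>2\<close>. Interpolating \<open>Q\<close>, and also \<open>p'\<close>, for which all coefficients
  are 1, one obtains \<open>Q'(\<eta>) = - p(\<eta>) \<Sum> \<lambda>\<^sub>x / (\<eta> - x)\<^sup>2\<close> and \<open>p''(\<eta>) = - p(\<eta>) \<Sum> 1 / (\<eta> - x)\<^sup>2\<close>. So the
  velocity of \<open>\<eta>\<close> is a mean, with positive weights, of the velocities of the roots of \<open>p\<close>.
\<close>
lemma velocity_pderiv_pos:
  assumes sh: "strictly_hyperbolic p" and "degree Q < degree p"
    and nonneg: "\<And>x. poly p x = 0 \<Longrightarrow> 0 \<le> poly Q x / poly (pderiv p) x"
    and "Q \<noteq> 0" and \<eta>: "poly (pderiv p) \<eta> = 0"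
  shows "0 < poly (pderiv Q) \<eta> / poly (pderiv (pderiv p)) \<eta>"
proof -
  let ?Z = "{x. poly p x = 0}"
  define w where "w x = 1 / (\<eta> - x)\<^sup>2" for x
  obtain q where fac: "\<And>x. poly p x = 0 \<Longrightarrow> p = [:-x, 1:] * q x"
    and lag: "\<And>Q. degree Q < degree p \<Longrightarrow> Q = (\<Sum>x\<in>?Z. smult (poly Q x / poly (pderiv p) x) (q x))"
    using lagrange_cofactors[OF sh] by metis
  have ne: "poly p \<eta> \<noteq> 0" using strictly_hyperbolic_simple_root[OF sh] \<eta> by blast
  have dq: "poly (pderiv (q x)) \<eta> = - poly p \<eta> * w x" if "x \<in> ?Z" for x
  proof -
    have x: "poly p x = 0" using that by simp
    have "poly (pderiv p) \<eta> = (\<eta> - x) * poly (pderiv (q x)) \<eta> + poly (q x) \<eta>"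
      by (subst fac[OF x]) (simp only: pderiv_mult, simp add: pderiv_pCons algebra_simps)
    moreover have "poly p \<eta> = (\<eta> - x) * poly (q x) \<eta>"
      by (subst fac[OF x]) (simp add: algebra_simps)
    moreover have "\<eta> - x \<noteq> 0" using ne x by auto
    ultimately show ?thesis using \<eta> by (simp add: w_def power2_eq_square divide_simps) algebra
  qed
  have deriv: "poly (pderiv Q) \<eta> = - poly p \<eta> * (\<Sum>x\<in>?Z. poly Q x / poly (pderiv p) x * w x)"
    if "degree Q < degree p" for Q
  proof -
    have "poly (pderiv Q) \<eta> = (\<Sum>x\<in>?Z. poly Q x / poly (pderiv p) x * poly (pderiv (q x)) \<eta>)"
      by (subst lag[OF that]) (simp add: higher_pderiv_sum[of 1, simplified] pderiv_smult poly_sum)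
    also have "\<dots> = (\<Sum>x\<in>?Z. poly Q x / poly (pderiv p) x * (- poly p \<eta> * w x))"
      using dq by (intro sum.cong) auto
    finally show ?thesis by (simp add: sum_distrib_left mult_ac)
  qed
  have w: "0 < w x" if "x \<in> ?Z" for x using that ne by (auto simp: w_def)
  have fin: "finite ?Z" using strictly_hyperbolicD[OF sh] by blast
  have "\<exists>x\<in>?Z. poly Q x / poly (pderiv p) x \<noteq> 0"
    using lag[OF assms(2)] \<open>Q \<noteq> 0\<close> by (metis (no_types, lifting) smult_0_left sum.neutral)
  then obtain x0 where x0: "x0 \<in> ?Z" "poly Q x0 / poly (pderiv p) x0 \<noteq> 0" by blast
  have num: "0 < (\<Sum>x\<in>?Z. poly Q x / poly (pderiv p) x * w x)"
  proof (rule sum_pos2[OF fin x0(1)])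
    show "0 < poly Q x0 / poly (pderiv p) x0 * w x0"
      using x0 nonneg[of x0] w[OF x0(1)] by (intro mult_pos_pos) (simp_all add: less_le del: zero_less_divide_iff)
    show "0 \<le> poly Q x / poly (pderiv p) x * w x" if "x \<in> ?Z" for x
      using nonneg[of x] w[OF that] that by (intro mult_nonneg_nonneg) auto
  qed
  have "0 < (\<Sum>x\<in>?Z. w x)" by (rule sum_pos) (use fin x0 w in auto)
  moreover have "poly (pderiv (pderiv p)) \<eta> = - poly p \<eta> * (\<Sum>x\<in>?Z. w x)"
  proof -
    have "degree (pderiv p) < degree p" using assms(2) by (simp add: degree_pderiv)
    from deriv[OF this] show ?thesis
      using strictly_hyperbolic_simple_root[OF sh] by simp
  qed
  ultimately show ?thesis using num deriv[OF assms(2)] ne by (simp add: zero_less_divide_iff zero_less_mult_iff mult_less_0_iff)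
qed

text \<open>
  Moving only the root \<open>c\<close> to the right gives the roots of \<open>p\<close> velocities 0 and 1. Taking weighted
  means once makes all velocities positive, and further derivatives keep them so.
\<close>
lemma velocity_higher_pderiv_pos:
  assumes sh: "strictly_hyperbolic p" and fac: "p = [:-c, 1:] * Q"
    and "0 < k" "k < degree p" and "poly ((pderiv ^^ k) p) \<eta> = 0"
  shows "0 < poly ((pderiv ^^ k) Q) \<eta> / poly ((pderiv ^^ Suc k) p) \<eta>"
proof -
  have Q: "Q \<noteq> 0" using fac strictly_hyperbolicD(1)[OF sh] by auto
  then have deg: "degree p = Suc (degree Q)" by (subst fac, subst degree_mult_eq) auto
  have step: "0 < poly ((pderiv ^^ Suc k) Q) \<eta> / poly ((pderiv ^^ Suc (Suc k)) p) \<eta>"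
    if "Suc k < degree p" "poly ((pderiv ^^ Suc k) p) \<eta> = 0"
      and "\<And>x. poly ((pderiv ^^ k) p) x = 0 \<Longrightarrow> 0 \<le> poly ((pderiv ^^ k) Q) x / poly ((pderiv ^^ Suc k) p) x"
    for k \<eta>
  proof -
    have "(pderiv ^^ k) Q \<noteq> 0"
    proof (cases "k = 0")
      case False
      then obtain m where m: "k = Suc m" by (cases k) auto
      then show ?thesis using that(1) deg by (simp add: pderiv_eq_0_iff degree_higher_pderiv)
    qed (use Q in simp)
    then show ?thesis
      using velocity_pderiv_pos[of "(pderiv ^^ k) p" "(pderiv ^^ k) Q" \<eta>]
        strictly_hyperbolic_higher_pderiv[OF sh, of k] that deg
      by (simp add: degree_higher_pderiv)
  qed
  have base: "0 \<le> poly Q x / poly (pderiv p) x" if "poly p x = 0" for x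
  proof (cases "x = c")
    case True
    have "poly (pderiv p) c = poly Q c"
      by (subst fac) (simp only: pderiv_mult, simp add: pderiv_pCons)
    then show ?thesis using True by simp
  next
    case False
    then show ?thesis using that by (subst (asm) fac) auto
  qed
  show ?thesis using assms(3-5)
  proof (induction k arbitrary: \<eta>)
    case (Suc k)
    show ?case
    proof (rule step)
      show "0 \<le> poly ((pderiv ^^ k) Q) x / poly ((pderiv ^^ Suc k) p) x"
        if "poly ((pderiv ^^ k) p) x = 0" for x
        using Suc.IH[of x] Suc.prems that base[of x] by (cases "k = 0") (auto intro: less_imp_le)
    qed (use Suc.prems in auto)
  qed simp
qed

section \<open>Regularity of the ordered roots\<close>

lemma simple_root_sign_change:
  assumes "poly p r = 0" and "poly (pderiv p) r \<noteq> 0" and "0 < (e::real)"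
  obtains d where "0 < d" "d < e" "poly p (r - d) * poly p (r + d) < 0"
proof -
  have pos: "\<exists>d. 0 < d \<and> d < e \<and> poly p (r - d) < 0 \<and> 0 < poly p (r + d)"
    if p: "poly p r = 0" "0 < poly (pderiv p) r" for p
  proof -
    obtain d1 where d1: "0 < d1" "\<And>h. 0 < h \<Longrightarrow> h < d1 \<Longrightarrow> poly p r < poly p (r + h)"
      using DERIV_pos_inc_right[OF poly_DERIV p(2)] by blast
    obtain d2 where d2: "0 < d2" "\<And>h. 0 < h \<Longrightarrow> h < d2 \<Longrightarrow> poly p (r - h) < poly p r"
      using DERIV_pos_inc_left[OF poly_DERIV p(2)] by blast
    define d where "d = min e (min d1 d2) / 2"
    have "0 < d" "d < e" "d < d1" "d < d2" using d1(1) d2(1) assms(3) by (auto simp: d_def min_def)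
    then show ?thesis using d1(2)[of d] d2(2)[of d] p(1) by auto
  qed
  show thesis
  proof (cases "0 < poly (pderiv p) r")
    case True
    then show ?thesis using pos[OF assms(1)] that by (metis mult_neg_pos)
  next
    case False
    then have "poly (- p) r = 0" "0 < poly (pderiv (- p)) r"
      using assms(1,2) by (auto simp: pderiv_minus)
    then obtain d where "0 < d" "d < e" "poly p (r + d) < 0" "0 < poly p (r - d)"
      using pos[of "- p"] by auto
    then show ?thesis using that[of d] by (simp add: mult_pos_neg)
  qed
qed

text \<open>
  A simple root is caught between two nearby points at which the polynomial has opposite signs, a
  condition that survives small changes. With disjoint neighbourhoods of the roots, nearby polynomials
  thus have one root in each of them, in the same order.
\<close>
lemma tendsto_ordered_root:
  fixes p :: "'a \<Rightarrow> real poly"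
  assumes sh: "strictly_hyperbolic p0"
    and lim: "\<And>x. ((\<lambda>a. poly (p a) x) \<longlongrightarrow> poly p0 x) F"
    and deg: "\<forall>\<^sub>F a in F. degree (p a) = degree p0" and j: "j \<in> {1..degree p0}"
  shows "((\<lambda>a. ordered_root (p a) j) \<longlongrightarrow> ordered_root p0 j) F"
proof (rule tendstoI)
  fix e :: real assume "0 < e"
  let ?I = "{1..degree p0}"
  define r where "r = ordered_root p0"
  note ord = strictly_hyperbolic_ordered_root[OF sh, folded r_def]
  \<comment> \<open>a radius below \<open>e\<close> for which the neighbourhoods of the roots are disjoint\<close>
  have "\<forall>\<^sub>F \<delta> in at_right 0. \<forall>i\<in>?I. \<forall>k\<in>?I. i < k \<longrightarrow> r i + \<delta> < r k - \<delta>"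
  proof (intro eventually_ball_finite ballI finite_atLeastAtMost)
    fix i k assume "i \<in> ?I" "k \<in> ?I"
    show "\<forall>\<^sub>F \<delta> in at_right 0. i < k \<longrightarrow> r i + \<delta> < r k - \<delta>"
    proof (cases "i < k")
      case True
      then have "r i < r k" using strict_mono_onD[OF ord(2)] \<open>i \<in> ?I\<close> \<open>k \<in> ?I\<close> by blast
      have "((\<lambda>\<delta>. r i + \<delta> - (r k - \<delta>)) \<longlongrightarrow> r i + 0 - (r k - 0)) (at_right 0)"
        by (intro tendsto_intros)
      then have "\<forall>\<^sub>F \<delta> in at_right 0. r i + \<delta> - (r k - \<delta>) < 0"
        using \<open>r i < r k\<close> by (auto elim!: order_tendstoD)
      then show ?thesis by (auto elim: eventually_mono)
    qed simp
  qed
  moreover have "\<forall>\<^sub>F \<delta> in at_right 0. (0::real) < \<delta> \<and> \<delta> < e"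
    using eventually_at_right_real[OF \<open>0 < e\<close>] by (auto elim: eventually_mono)
  ultimately have "\<forall>\<^sub>F \<delta> in at_right 0. (\<forall>i\<in>?I. \<forall>k\<in>?I. i < k \<longrightarrow> r i + \<delta> < r k - \<delta>) \<and> 0 < \<delta> \<and> \<delta> < e"
    by (rule eventually_conj)
  then obtain \<delta> where \<delta>: "0 < \<delta>" "\<delta> < e" and sep: "\<And>i k. i \<in> ?I \<Longrightarrow> k \<in> ?I \<Longrightarrow> i < k \<Longrightarrow> r i + \<delta> < r k - \<delta>"
    using eventually_happens'[OF trivial_limit_at_right_real] by blast
  have root: "poly p0 (r i) = 0" if "i \<in> ?I" for i using bij_betwE[OF ord(1)] that by blast
  have "\<exists>d. 0 < d \<and> d < \<delta> \<and> poly p0 (r i - d) * poly p0 (r i + d) < 0" if "i \<in> ?I" for i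
    using simple_root_sign_change[OF root[OF that] strictly_hyperbolic_simple_root[OF sh root[OF that]] \<delta>(1)]
    by metis
  then obtain d where d: "\<And>i. i \<in> ?I \<Longrightarrow> 0 < d i \<and> d i < \<delta> \<and> poly p0 (r i - d i) * poly p0 (r i + d i) < 0"
    by metis
  have "\<forall>\<^sub>F a in F. \<forall>i\<in>?I. poly (p a) (r i - d i) * poly (p a) (r i + d i) < 0"
    by (intro eventually_ball_finite ballI order_tendstoD(2)[OF tendsto_mult[OF lim lim]]) (use d in auto)
  with deg show "\<forall>\<^sub>F a in F. dist (ordered_root (p a) j) (ordered_root p0 j) < e"
  proof eventually_elim
    case (elim a)
    have "\<exists>y. r i - d i < y \<and> y < r i + d i \<and> poly (p a) y = 0" if "i \<in> ?I" for i
      using poly_IVT[of "r i - d i" "r i + d i" "p a"] elim(2) d[OF that] that by auto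
    then obtain y where y: "\<And>i. i \<in> ?I \<Longrightarrow> r i - d i < y i \<and> y i < r i + d i \<and> poly (p a) (y i) = 0"
      by metis
    have mono: "strict_mono_on ?I y"
    proof (rule strict_mono_onI)
      fix i k assume ik: "i \<in> ?I" "k \<in> ?I" "i < k"
      show "y i < y k" using sep[OF ik] y[OF ik(1)] y[OF ik(2)] d[OF ik(1)] d[OF ik(2)] by linarith
    qed
    have "p a \<noteq> 0" using elim(2) j by auto
    then have "ordered_root (p a) j = y j"
      using strictly_hyperbolicI_increasing_roots(2)[of "p a" y j] mono y elim(1) j by simp
    then show ?case using y[OF j] d[OF j] \<delta>(2) by (simp add: dist_real_def r_def abs_less_iff)
  qed
qed

text \<open>
  The monic polynomials and each of their higher derivatives form families of this shape, so the
  regularity of roots need only be proved once.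
\<close>
definition affine_family :: "real poly \<Rightarrow> ('n::finite \<Rightarrow> real poly) \<Rightarrow> real ^ 'n \<Rightarrow> real poly" where
  "affine_family A M a = A + (\<Sum>i\<in>UNIV. smult (a $ i) (M i))"

lemma poly_affine_family:
  "poly (affine_family A M a) x = poly A x + (\<Sum>i\<in>UNIV. a $ i * poly (M i) x)"
  by (simp add: affine_family_def poly_sum)

lemma higher_pderiv_affine_family:
  "(pderiv ^^ k) (affine_family A M a) = affine_family ((pderiv ^^ k) A) (\<lambda>i. (pderiv ^^ k) (M i)) a"
  by (simp add: affine_family_def higher_pderiv_add higher_pderiv_sum higher_pderiv_smult)

lemma pderiv_affine_family:
  "pderiv (affine_family A M a) = affine_family (pderiv A) (\<lambda>i. pderiv (M i)) a"
  using higher_pderiv_affine_family[of 1 A M a] by simp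

text \<open>
  In a product whose first factor vanishes at \<open>a0\<close>, mere convergence of the second factor
  suffices for differentiability at \<open>a0\<close>.
\<close>
lemma has_derivative_vanishing_component_mult:
  fixes a0 :: "real ^ 'n"
  assumes "(g \<longlongrightarrow> (c::real)) (at a0)"
  shows "((\<lambda>a. (a - a0) $ i * g a) has_derivative (\<lambda>v. v $ i * c)) (at a0)"
proof (rule has_derivativeI_sandwich[where e = 1 and H = "\<lambda>a. \<bar>g a - c\<bar>"])
  show "bounded_linear (\<lambda>v::real ^ 'n. v $ i * c)"
    using bounded_linear_compose[OF bounded_linear_mult_left bounded_linear_vec_nth] .
  show "((\<lambda>a. \<bar>g a - c\<bar>) \<longlongrightarrow> 0) (at a0)"
    using assms by (simp add: LIM_zero tendsto_rabs_zero)
  fix a :: "real ^ 'n" assume "a \<noteq> a0"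
  have "norm (((a - a0) $ i * g a - (a0 - a0) $ i * g a0) - (a - a0) $ i * c)
      = \<bar>(a - a0) $ i\<bar> * \<bar>g a - c\<bar>"
    by (simp add: abs_mult[symmetric] right_diff_distrib)
  also have "\<dots> \<le> norm (a - a0) * \<bar>g a - c\<bar>"
    by (rule mult_right_mono[OF component_le_norm_cart]) simp
  finally show "norm (((a - a0) $ i * g a - (a0 - a0) $ i * g a0) - (a - a0) $ i * c) / norm (a - a0)
      \<le> \<bar>g a - c\<bar>"
    using \<open>a \<noteq> a0\<close> by (simp add: divide_le_eq mult.commute)
qed simp

text \<open>
  With \<open>p\<^sub>0\<close> the polynomial at \<open>a0\<close> and \<open>\<xi>\<^sub>0\<close> its root, write \<open>p\<^sub>0 = (X - \<xi>\<^sub>0) q\<close>. The equation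
  satisfied by a nearby root \<open>\<xi>\<close> can be solved exactly:
  \<open>\<xi> - \<xi>\<^sub>0 = - (\<Sum>i. (a - a0)\<^sub>i M\<^sub>i(\<xi>)) / q(\<xi>)\<close>, and here the quotients \<open>M\<^sub>i(\<xi>) / q(\<xi>)\<close> converge because
  \<open>\<xi>\<close> is continuous and \<open>q(\<xi>\<^sub>0) = p\<^sub>0'(\<xi>\<^sub>0)\<close> is nonzero.
\<close>
lemma ordered_root_affine_family_has_derivative:
  fixes a0 :: "real ^ 'n"
  assumes "open U" and a0: "a0 \<in> U" and j: "j \<in> {1..N}"
    and sh: "\<And>a. a \<in> U \<Longrightarrow> strictly_hyperbolic (affine_family A M a) \<and> degree (affine_family A M a) = N"
  defines "\<xi> \<equiv> \<lambda>a. ordered_root (affine_family A M a) j"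
  shows "(\<xi> has_derivative
      (\<lambda>v. - poly (affine_family 0 M v) (\<xi> a0) / poly (pderiv (affine_family A M a0)) (\<xi> a0))) (at a0)"
proof -
  let ?p = "affine_family A M"
  have root: "poly (?p a) (\<xi> a) = 0" if "a \<in> U" for a
    using bij_betwE[OF strictly_hyperbolic_ordered_root(1)[of "?p a"]] sh[OF that] j by (auto simp: \<xi>_def)
  have inU: "\<forall>\<^sub>F a in at a0. a \<in> U" by (rule eventually_at_in_open'[OF \<open>open U\<close> a0])
  have lim: "(\<xi> \<longlongrightarrow> \<xi> a0) (at a0)"
    unfolding \<xi>_def
  proof (rule tendsto_ordered_root)
    show "((\<lambda>a. poly (?p a) x) \<longlongrightarrow> poly (?p a0) x) (at a0)" for x
      unfolding poly_affine_family by (intro tendsto_intros)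
    show "\<forall>\<^sub>F a in at a0. degree (?p a) = degree (?p a0)"
      using inU by eventually_elim (use sh a0 in simp)
  qed (use sh[OF a0] j in auto)
  obtain q where q: "?p a0 = [:- \<xi> a0, 1:] * q"
    using root[OF a0] by (auto simp: poly_eq_0_iff_dvd elim: dvdE)
  have q0: "poly q (\<xi> a0) = poly (pderiv (?p a0)) (\<xi> a0)"
    unfolding q by (simp only: pderiv_mult) (simp add: pderiv_pCons)
  then have q_ne: "poly q (\<xi> a0) \<noteq> 0"
    using strictly_hyperbolic_simple_root[of "?p a0"] sh[OF a0] root[OF a0] by simp
  define g where "g i a = - poly (M i) (\<xi> a) / poly q (\<xi> a)" for i a
  have g: "(g i \<longlongrightarrow> g i a0) (at a0)" for i
    unfolding g_def by (intro tendsto_intros lim q_ne)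
  have "\<forall>\<^sub>F a in at a0. poly q (\<xi> a) \<noteq> 0"
    by (rule tendsto_imp_eventually_ne[OF tendsto_poly[OF lim] q_ne])
  with inU have eq: "\<forall>\<^sub>F a in at a0. \<xi> a0 + (\<Sum>i\<in>UNIV. (a - a0) $ i * g i a) = \<xi> a"
  proof eventually_elim
    case (elim a)
    have "0 = poly (?p a0) (\<xi> a) + (\<Sum>i\<in>UNIV. (a - a0) $ i * poly (M i) (\<xi> a))"
      using root[OF elim(1)] by (simp add: poly_affine_family left_diff_distrib sum_subtractf)
    also have "poly (?p a0) (\<xi> a) = (\<xi> a - \<xi> a0) * poly q (\<xi> a)"
      unfolding q by (simp add: algebra_simps)
    finally have "(\<xi> a - \<xi> a0) * poly q (\<xi> a) = - (\<Sum>i\<in>UNIV. (a - a0) $ i * poly (M i) (\<xi> a))"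
      by linarith
    then have "\<xi> a - \<xi> a0 = - (\<Sum>i\<in>UNIV. (a - a0) $ i * poly (M i) (\<xi> a)) / poly q (\<xi> a)"
      by (simp only: nonzero_eq_divide_eq[OF elim(2)])
    also have "\<dots> = (\<Sum>i\<in>UNIV. (a - a0) $ i * g i a)"
      by (simp add: g_def sum_divide_distrib sum_negf)
    finally show ?case by simp
  qed
  have "((\<lambda>a. \<xi> a0 + (\<Sum>i\<in>UNIV. (a - a0) $ i * g i a)) has_derivative (\<lambda>v. 0 + (\<Sum>i\<in>UNIV. v $ i * g i a0))) (at a0)"
    by (intro has_derivative_add has_derivative_const has_derivative_sum has_derivative_vanishing_component_mult g)
  then have "(\<xi> has_derivative (\<lambda>v. 0 + (\<Sum>i\<in>UNIV. v $ i * g i a0))) (at a0)"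
    by (rule has_derivative_transform_eventually[OF _ eq]) auto
  also have "(\<lambda>v. 0 + (\<Sum>i\<in>UNIV. v $ i * g i a0))
      = (\<lambda>v. - poly (affine_family 0 M v) (\<xi> a0) / poly (pderiv (?p a0)) (\<xi> a0))"
    by (simp add: g_def q0 poly_affine_family sum_divide_distrib sum_negf fun_eq_iff)
  finally show ?thesis .
qed

text \<open>
  The derivative of a root is a rational expression in the parameters and in the root itself, so that
  differentiability of one order gives the next.
\<close>
lemma ordered_root_affine_family_smooth_on:
  fixes A :: "real poly" and M :: "'n::finite \<Rightarrow> real poly"
  assumes "open U" and j: "j \<in> {1..N}"
    and sh: "\<And>a. a \<in> U \<Longrightarrow> strictly_hyperbolic (affine_family A M a) \<and> degree (affine_family A M a) = N"
  shows "smooth_on U (\<lambda>a. ordered_root (affine_family A M a) j)" (is "smooth_on U ?\<xi>")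
proof -
  note der = ordered_root_affine_family_has_derivative[OF \<open>open U\<close> _ j sh]
  let ?d = "\<lambda>a. poly (pderiv (affine_family A M a)) (?\<xi> a)"
  have ne: "?d a \<noteq> 0" if "a \<in> U" for a
    using bij_betwE[OF strictly_hyperbolic_ordered_root(1)[of "affine_family A M a"]] sh[OF that] j
    by (intro strictly_hyperbolic_simple_root) auto
  have "higher_differentiable_on U ?\<xi> m" for m
  proof (induction m)
    case 0
    show ?case
      using has_derivative_continuous[OF der] by (auto intro!: continuous_at_imp_continuous_on)
  next
    case (Suc m)
    have mono: "higher_differentiable_on U (\<lambda>a. poly q (?\<xi> a)) m" for q
      by (rule higher_differentiable_on_poly[OF \<open>open U\<close> Suc])
    have comp: "higher_differentiable_on U (\<lambda>a. a $ i) m" for i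
      by (rule higher_differentiable_on_bounded_linear[OF \<open>open U\<close> bounded_linear_vec_nth])
    have d: "higher_differentiable_on U ?d m"
      unfolding pderiv_affine_family poly_affine_family
      by (intro higher_differentiable_on_add higher_differentiable_on_sum higher_differentiable_on_mult
          mono comp \<open>open U\<close>)
    have "higher_differentiable_on U (\<lambda>a. - 1 * poly (affine_family 0 M v) (?\<xi> a) * inverse (?d a)) m" for v
      by (intro higher_differentiable_on_mult higher_differentiable_on_inverse higher_differentiable_on_const
          mono d ne \<open>open U\<close>)
    then show ?case
      by (intro higher_differentiable_on_SucI[OF \<open>open U\<close> der]) (simp_all add: divide_inverse)
  qed
  then show ?thesis by (simp add: smooth_on_def)
qed

section \<open>The interior of the hyperbolicity domain\<close>

lemma map_poly_of_real_mult:
  "map_poly of_real (p * q) = map_poly of_real p * (map_poly of_real q :: complex poly)"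
  by (rule poly_eqI) (simp add: coeff_map_poly coeff_mult)

lemma poly_map_poly_of_real:
  "poly (map_poly of_real p) (of_real x) = (of_real (poly p x) :: complex)"
  by (induction p) (auto simp: map_poly_pCons)

lemma hyperbolic_size_proots:
  assumes "hyperbolic p" and "p \<noteq> 0"
  shows "size (proots p) = degree p"
  using assms
proof (induction "degree p" arbitrary: p)
  case 0
  then show ?case using size_proots_le[of p] by simp
next
  case (Suc d)
  have "0 < degree (map_poly of_real p :: complex poly)"
    using Suc.hyps(2)[symmetric] by (simp add: degree_map_poly)
  from alg_closed_imp_poly_has_root[OF this]
  obtain z :: complex where z: "poly (map_poly of_real p) z = 0" ..
  then have "z \<in> \<real>" using Suc.prems(1) by (simp add: hyperbolic_def)
  then obtain r where "z = of_real r" by (rule Reals_cases)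
  then have "poly p r = 0" using z by (simp add: poly_map_poly_of_real)
  then obtain q where q: "p = [:-r, 1:] * q" by (auto simp: poly_eq_0_iff_dvd elim: dvdE)
  with Suc.prems(2) have "q \<noteq> 0" by auto
  then have deg: "degree p = Suc (degree q)" unfolding q by (subst degree_mult_eq) auto
  have "hyperbolic q"
    using Suc.prems(1) unfolding q hyperbolic_def map_poly_of_real_mult by simp
  then have "size (proots q) = degree q" using Suc.hyps deg \<open>q \<noteq> 0\<close> by simp
  moreover have "proots p = proots [:-r, 1:] + proots q"
    unfolding q by (rule proots_mult) (use \<open>q \<noteq> 0\<close> in auto)
  ultimately show ?case using deg by simp
qed

lemma not_hyperbolic_if_nonreal_quadratic_factor:
  assumes "0 < e"
  shows "\<not> hyperbolic ([:r\<^sup>2 + e, - 2 * r, 1:] * q)"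
proof
  let ?z = "Complex r (sqrt e)"
  assume "hyperbolic ([:r\<^sup>2 + e, - 2 * r, 1:] * q)"
  moreover have "poly (map_poly of_real [:r\<^sup>2 + e, - 2 * r, 1:]) ?z = 0"
    using assms by (simp add: map_poly_pCons complex_eq_iff power2_eq_square algebra_simps)
  ultimately have "?z \<in> \<real>"
    unfolding hyperbolic_def map_poly_of_real_mult by simp
  then show False using assms by (simp add: complex_is_Real_iff)
qed

text \<open>
  A polynomial \<open>(X - x)\<^sup>2 q\<close> with a multiple root leaves the set of hyperbolic ones when moved in
  direction \<open>q\<close>: the factor \<open>(X - x)\<^sup>2 + e\<close> has no real root for \<open>e > 0\<close>.
\<close>
lemma strictly_hyperbolic_if_stable:
  assumes hyp: "hyperbolic p" and "p \<noteq> 0"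
    and stable: "\<And>q. degree q < degree p \<Longrightarrow> \<exists>e>0. hyperbolic (p + smult e q)"
  shows "strictly_hyperbolic p"
proof -
  have "order x p \<le> 1" for x
  proof (rule ccontr)
    assume "\<not> order x p \<le> 1"
    then have "[:-x, 1:] ^ 2 dvd p" by (intro order_divides[THEN iffD2]) auto
    then obtain q where q: "p = [:-x, 1:] ^ 2 * q" by (elim dvdE)
    with \<open>p \<noteq> 0\<close> have "q \<noteq> 0" by auto
    then have "degree q < degree p"
      unfolding q by (subst degree_mult_eq) (auto simp: degree_power_eq)
    then obtain e where "0 < e" "hyperbolic (p + smult e q)" using stable by blast
    moreover have "p + smult e q = [:x\<^sup>2 + e, - 2 * x, 1:] * q"
      unfolding q poly_eq_poly_eq_iff[symmetric]
      by (simp add: fun_eq_iff power2_eq_square algebra_simps)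
    ultimately show False using not_hyperbolic_if_nonreal_quadratic_factor by simp
  qed
  then have "order x p = (if poly p x = 0 then 1 else 0)" for x
    using \<open>p \<noteq> 0\<close> order_root[of p x] by (auto simp: le_antisym Suc_leI)
  then have "count (proots p) x = (if poly p x = 0 then 1 else 0)" for x
    using \<open>p \<noteq> 0\<close> by simp
  then have "proots p = mset_set {x. poly p x = 0}"
    using \<open>p \<noteq> 0\<close> by (intro multiset_eqI) (simp add: count_mset_set' poly_roots_finite)
  then have "card {x. poly p x = 0} = degree p"
    using hyperbolic_size_proots[OF hyp \<open>p \<noteq> 0\<close>] by simp
  with \<open>p \<noteq> 0\<close> show ?thesis by (simp add: strictly_hyperbolic_def)
qed

definition tail_poly :: "(nat \<Rightarrow> 'n) \<Rightarrow> real ^ 'n \<Rightarrow> real poly" where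
  "tail_poly idx v = (\<Sum>l = 1..CARD('n). monom (v $ idx l) (CARD('n) - l))"

lemma monic_poly_tail: "monic_poly idx a = monom 1 CARD('n) + tail_poly idx (a :: real ^ 'n)"
  by (simp add: monic_poly_def tail_poly_def)

lemma monic_poly_add_scaleR:
  "monic_poly idx (a + e *\<^sub>R v) = monic_poly idx a + smult e (tail_poly idx v)"
proof -
  have "tail_poly idx (a + e *\<^sub>R v) = tail_poly idx a + smult e (tail_poly idx v)"
    by (rule poly_eq_poly_eq_iff[THEN iffD1])
      (simp add: fun_eq_iff tail_poly_def poly_sum poly_monom sum.distrib sum_distrib_left algebra_simps)
  then show ?thesis by (simp add: monic_poly_tail)
qed

lemma degree_tail_poly: "degree (tail_poly idx v) < CARD('n)" for v :: "real ^ 'n::finite"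
  unfolding tail_poly_def
  by (rule degree_sum_less) (auto intro: le_less_trans[OF degree_monom_le])

lemma degree_monic_poly: "degree (monic_poly idx a) = CARD('n)" for a :: "real ^ 'n::finite"
  unfolding monic_poly_tail using degree_tail_poly[of idx a]
  by (subst degree_add_eq_left) (simp_all add: degree_monom_eq)

lemma monic_poly_nonzero: "monic_poly idx a \<noteq> 0" for a :: "real ^ 'n::finite"
  using degree_monic_poly[of idx a] by auto

text \<open>
  Perturbations may therefore be chosen as polynomials, such as cofactors of roots, instead of as
  coefficient vectors.
\<close>
lemma tail_poly_surj:
  fixes idx :: "nat \<Rightarrow> 'n::finite"
  assumes bij: "bij_betw idx {1..CARD('n)} UNIV" and V: "degree V < CARD('n)"
  obtains v where "tail_poly idx v = V"
proof
  let ?n = "CARD('n)"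
  have "tail_poly idx (\<chi> i. coeff V (?n - inv_into {1..?n} idx i))
      = (\<Sum>l = 1..?n. monom (coeff V (?n - l)) (?n - l))"
    unfolding tail_poly_def
    by (intro sum.cong refl) (simp only: vec_lambda_beta inv_into_f_f[OF bij_betw_imp_inj_on[OF bij]])
  also have "\<dots> = (\<Sum>m\<le>?n - 1. monom (coeff V m) m)"
    by (rule sum.reindex_bij_witness[where i = "\<lambda>m. ?n - m" and j = "\<lambda>l. ?n - l"]) (use V in auto)
  also have "\<dots> = V" by (rule poly_as_sum_of_monoms') (use V in simp)
  finally show "tail_poly idx (\<chi> i. coeff V (?n - inv_into {1..?n} idx i)) = V" .
qed

lemma strictly_hyperbolic_interior:
  fixes idx :: "nat \<Rightarrow> 'n::finite"
  assumes bij: "bij_betw idx {1..CARD('n)} UNIV" and a: "a \<in> interior (hyperbolicity_domain idx)"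
  shows "strictly_hyperbolic (monic_poly idx a)"
proof (rule strictly_hyperbolic_if_stable)
  show "hyperbolic (monic_poly idx a)"
    using a interior_subset by (auto simp: hyperbolicity_domain_def)
  show "monic_poly idx a \<noteq> 0" by (rule monic_poly_nonzero)
  fix q :: "real poly" assume "degree q < degree (monic_poly idx a)"
  then obtain v where v: "tail_poly idx v = q"
    using tail_poly_surj[OF bij] unfolding degree_monic_poly by blast
  have "((\<lambda>e. a + e *\<^sub>R v) \<longlongrightarrow> a + 0 *\<^sub>R v) (at_right 0)" by (intro tendsto_intros)
  then have "\<forall>\<^sub>F e in at_right 0. a + e *\<^sub>R v \<in> interior (hyperbolicity_domain idx)"
    by (rule topological_tendstoD) (use a in auto)
  then have "\<forall>\<^sub>F e in at_right 0. a + e *\<^sub>R v \<in> interior (hyperbolicity_domain idx) \<and> 0 < e"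
    by (intro eventually_conj eventually_at_right_less)
  then obtain e where "a + e *\<^sub>R v \<in> interior (hyperbolicity_domain idx)" "0 < e"
    using eventually_happens'[OF trivial_limit_at_right_real] by blast
  then have "a + e *\<^sub>R v \<in> hyperbolicity_domain idx" "0 < e" using interior_subset by auto
  then show "\<exists>e>0. hyperbolic (monic_poly idx a + smult e q)"
    using v by (auto simp: hyperbolicity_domain_def monic_poly_add_scaleR)
qed

section \<open>Roots as functions of the coefficients\<close>

lemma monic_poly_affine_family:
  fixes idx :: "nat \<Rightarrow> 'n::finite"
  assumes bij: "bij_betw idx {1..CARD('n)} UNIV"
  obtains M where "\<And>v. tail_poly idx v = affine_family 0 M v"
    and "\<And>a. monic_poly idx a = affine_family (monom 1 CARD('n)) M a"
proof
  define M :: "'n \<Rightarrow> real poly" where "M i = monom 1 (CARD('n) - inv_into {1..CARD('n)} idx i)" for i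
  have "tail_poly idx v = (\<Sum>l\<in>{1..CARD('n)}. smult (v $ idx l) (M (idx l)))" for v
    unfolding tail_poly_def M_def
    by (intro sum.cong refl) (simp only: smult_monom inv_into_f_f[OF bij_betw_imp_inj_on[OF bij]] mult_1_right)
  then have tail: "tail_poly idx v = (\<Sum>i\<in>UNIV. smult (v $ i) (M i))" for v
    by (simp only: sum.reindex_bij_betw[OF bij, of "\<lambda>i. smult (v $ i) (M i)"])
  show "tail_poly idx v = affine_family 0 M v" for v
    by (simp add: tail affine_family_def)
  show "monic_poly idx a = affine_family (monom 1 CARD('n)) M a" for a
    by (simp add: tail affine_family_def monic_poly_tail)
qed

lemma higher_pderiv_strictly_hyperbolic_interior:
  fixes idx :: "nat \<Rightarrow> 'n::finite"
  assumes "bij_betw idx {1..CARD('n)} UNIV" and "a \<in> interior (hyperbolicity_domain idx)" and "k \<le> CARD('n)"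
  shows "strictly_hyperbolic ((pderiv ^^ k) (monic_poly idx a))"
    and "degree ((pderiv ^^ k) (monic_poly idx a)) = CARD('n) - k"
  using strictly_hyperbolic_higher_pderiv[OF strictly_hyperbolic_interior[OF assms(1,2)]] assms(3)
  by (simp_all add: degree_higher_pderiv degree_monic_poly)

lemma poly_xroot:
  fixes idx :: "nat \<Rightarrow> 'n::finite"
  assumes "bij_betw idx {1..CARD('n)} UNIV" and "a \<in> interior (hyperbolicity_domain idx)"
    and "k \<le> CARD('n)" and "j \<in> {1..CARD('n) - k}"
  shows "poly ((pderiv ^^ k) (monic_poly idx a)) (xroot idx k j a) = 0"
  using bij_betwE[OF strictly_hyperbolic_ordered_root(1)[OF
        higher_pderiv_strictly_hyperbolic_interior(1)[OF assms(1-3)]]]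
    higher_pderiv_strictly_hyperbolic_interior(2)[OF assms(1-3)] assms(4)
  by (simp add: xroot_def)

lemma
  fixes idx :: "nat \<Rightarrow> 'n::finite"
  assumes bij: "bij_betw idx {1..CARD('n)} UNIV" and "k \<le> CARD('n)" and j: "j \<in> {1..CARD('n) - k}"
  shows xroot_smooth_on: "smooth_on (interior (hyperbolicity_domain idx)) (xroot idx k j)"
    and xroot_has_derivative: "\<And>a. a \<in> interior (hyperbolicity_domain idx) \<Longrightarrow>
      (xroot idx k j has_derivative
        (\<lambda>v. - poly ((pderiv ^^ k) (tail_poly idx v)) (xroot idx k j a) /
             poly ((pderiv ^^ Suc k) (monic_poly idx a)) (xroot idx k j a))) (at a)"
proof -
  let ?U = "interior (hyperbolicity_domain idx)"
  obtain M where tail: "\<And>v. tail_poly idx v = affine_family 0 M v"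
    and monic: "\<And>a. monic_poly idx a = affine_family (monom 1 CARD('n)) M a"
    using monic_poly_affine_family[OF bij] by metis
  let ?A = "(pderiv ^^ k) (monom 1 CARD('n))" and ?M = "\<lambda>i. (pderiv ^^ k) (M i)"
  have family: "(pderiv ^^ k) (monic_poly idx a) = affine_family ?A ?M a" for a
    by (simp only: monic higher_pderiv_affine_family)
  have root: "xroot idx k j = (\<lambda>a. ordered_root (affine_family ?A ?M a) j)"
    by (rule ext) (simp only: xroot_def family)
  have sh: "strictly_hyperbolic (affine_family ?A ?M a) \<and> degree (affine_family ?A ?M a) = CARD('n) - k"
    if "a \<in> ?U" for a
    using higher_pderiv_strictly_hyperbolic_interior[OF bij that assms(2)] unfolding family by blast
  show "smooth_on ?U (xroot idx k j)"
    unfolding root by (rule ordered_root_affine_family_smooth_on[OF open_interior j sh])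
  fix a assume a: "a \<in> ?U"
  have "affine_family 0 ?M v = (pderiv ^^ k) (tail_poly idx v)" for v
    by (simp add: tail higher_pderiv_affine_family)
  then show "(xroot idx k j has_derivative
        (\<lambda>v. - poly ((pderiv ^^ k) (tail_poly idx v)) (xroot idx k j a) /
             poly ((pderiv ^^ Suc k) (monic_poly idx a)) (xroot idx k j a))) (at a)"
    using ordered_root_affine_family_has_derivative[OF open_interior a j sh]
    unfolding root by (simp add: family[symmetric])
qed

section \<open>Independence of the differentials\<close>

text \<open>
  The factor of \<open>c e\<close> is the velocity of the root \<open>x e\<close> of \<open>p\<^sup>(\<^sup>k\<^sup>)\<close> relative to the root \<open>x e\<close> of
  \<open>p\<close>, in direction \<open>V\<close>. In the directions that move one of the roots \<open>x e'\<close> to the left, the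
  hypothesis becomes \<open>c\<^sub>e\<^sub>' = \<Sum> c\<^sub>e C\<^sub>e(x e')\<close>, that is, \<open>c = c C\<close>. Each row of the positive matrix
  \<open>C\<close> adds up to 1 over all roots \<open>y\<close> of \<open>p\<close>. As the smallest root \<open>y0\<close> is none of the \<open>x e\<close>, the
  entries in the columns present here add up to less, so multiplication by \<open>C\<close> strictly decreases the
  \<open>l\<^sup>1\<close> norm of a nonzero row vector.
\<close>
lemma relative_velocities_independent:
  assumes sh: "strictly_hyperbolic p" and "finite E"
    and x: "\<And>e. e \<in> E \<Longrightarrow> poly p (x e) = 0 \<and> poly ((pderiv ^^ k e) p) (x e) = 0 \<and> 0 < k e \<and> k e < degree p"
    and inj: "inj_on x E"
    and vanish: "\<And>V. degree V < degree p \<Longrightarrow>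
      (\<Sum>e\<in>E. c e * (poly V (x e) / poly (pderiv p) (x e)
                     - poly ((pderiv ^^ k e) V) (x e) / poly ((pderiv ^^ Suc (k e)) p) (x e))) = 0"
    and "e0 \<in> E"
  shows "c e0 = (0::real)"
proof -
  let ?Z = "{y. poly p y = 0}"
  note shD = strictly_hyperbolicD[OF sh]
  obtain q where fac: "\<And>y. poly p y = 0 \<Longrightarrow> p = [:-y, 1:] * q y"
    and lag: "\<And>Q. degree Q < degree p \<Longrightarrow> Q = (\<Sum>y\<in>?Z. smult (poly Q y / poly (pderiv p) y) (q y))"
    using lagrange_cofactors[OF sh] by metis
  define C where "C e y = poly ((pderiv ^^ k e) (q y)) (x e) / poly ((pderiv ^^ Suc (k e)) p) (x e)" for e y
  have C_pos: "0 < C e y" if "e \<in> E" "y \<in> ?Z" for e y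
    unfolding C_def using velocity_higher_pderiv_pos[OF sh fac] x[OF that(1)] that(2) by simp
  have C_sum: "(\<Sum>y\<in>?Z. C e y) = 1" if "e \<in> E" for e
  proof -
    have "degree (pderiv p) < degree p" using x[OF that] by (simp add: degree_pderiv)
    from lag[OF this] have "pderiv p = (\<Sum>y\<in>?Z. q y)"
      using strictly_hyperbolic_simple_root[OF sh] by simp
    then have "(pderiv ^^ Suc (k e)) p = (\<Sum>y\<in>?Z. (pderiv ^^ k e) (q y))"
      by (simp add: funpow_swap1 higher_pderiv_sum)
    moreover have "poly ((pderiv ^^ Suc (k e)) p) (x e) \<noteq> 0"
      using strictly_hyperbolic_simple_root[OF strictly_hyperbolic_higher_pderiv[OF sh, of "k e"]] x[OF that]
      by simp
    ultimately show ?thesis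
      by (simp add: C_def sum_divide_distrib[symmetric] poly_sum[symmetric] del: funpow.simps)
  qed
  \<comment> \<open>the direction \<open>V = q (x e')\<close> moves \<open>x e'\<close> and fixes all other roots of \<open>p\<close>\<close>
  have c: "c e' = (\<Sum>e\<in>E. c e * C e (x e'))" if e': "e' \<in> E" for e'
  proof -
    have root: "poly p (x e') = 0" using x[OF e'] by simp
    have "q (x e') \<noteq> 0" using fac[OF root] shD(1) by auto
    then have deg: "degree p = Suc (degree (q (x e')))"
      by (subst fac[OF root], subst degree_mult_eq) auto
    have "poly (q (x e')) (x e) / poly (pderiv p) (x e) = (if e = e' then 1 else 0)" if "e \<in> E" for e
    proof (cases "e = e'")
      case True
      have "poly (pderiv p) (x e') = poly (q (x e')) (x e')"
        using arg_cong[OF fac[OF root], of "\<lambda>p. poly (pderiv p) (x e')"]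
        by (simp only: pderiv_mult) (simp add: pderiv_pCons)
      then show ?thesis using True strictly_hyperbolic_simple_root[OF sh root] by simp
    next
      case False
      then have "x e \<noteq> x e'" using inj that e' by (auto dest: inj_onD)
      moreover have "poly ([:- x e', 1:] * q (x e')) (x e) = 0"
        using fac[OF root] x[OF that] by metis
      ultimately show ?thesis using False by simp
    qed
    then have "0 = (\<Sum>e\<in>E. c e * ((if e = e' then 1 else 0) - C e (x e')))"
      using vanish[of "q (x e')"] deg by (simp add: C_def)
    also have "\<dots> = (\<Sum>e\<in>E. (if e = e' then c e else 0)) - (\<Sum>e\<in>E. c e * C e (x e'))"
      unfolding sum_subtractf[symmetric] by (intro sum.cong) (auto simp: right_diff_distrib)
    also have "(\<Sum>e\<in>E. (if e = e' then c e else 0)) = c e'" using \<open>finite E\<close> e' by simp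
    finally show ?thesis by simp
  qed
  define y0 where "y0 = Min ?Z"
  have "?Z \<noteq> {}" using x[OF \<open>e0 \<in> E\<close>] by auto
  then have y0: "y0 \<in> ?Z" "\<And>y. y \<in> ?Z \<Longrightarrow> y0 \<le> y" using Min_in[OF shD(2)] shD(2) unfolding y0_def by (blast, simp)
  have y0_not: "x e \<noteq> y0" if e: "e \<in> E" for e
  proof -
    obtain y where "y < x e" "poly p y = 0"
      using root_below_higher_pderiv_root[OF sh, of "k e" "x e"] x[OF e] by auto
    then show ?thesis using y0(2)[of y] by auto
  qed
  have "(\<Sum>e'\<in>E. \<bar>c e'\<bar>) \<le> (\<Sum>e'\<in>E. \<Sum>e\<in>E. \<bar>c e\<bar> * C e (x e'))"
  proof (rule sum_mono)
    fix e' assume e': "e' \<in> E"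
    have "\<bar>c e'\<bar> \<le> (\<Sum>e\<in>E. \<bar>c e * C e (x e')\<bar>)"
      using sum_abs[of "\<lambda>e. c e * C e (x e')" E] c[OF e'] by simp
    also have "\<dots> = (\<Sum>e\<in>E. \<bar>c e\<bar> * C e (x e'))"
      using C_pos x[OF e'] by (intro sum.cong) (auto simp: abs_mult less_imp_le)
    finally show "\<bar>c e'\<bar> \<le> (\<Sum>e\<in>E. \<bar>c e\<bar> * C e (x e'))" .
  qed
  also have "\<dots> = (\<Sum>e\<in>E. \<bar>c e\<bar> * (\<Sum>y\<in>x ` E. C e y))"
    by (subst sum.swap) (simp add: sum_distrib_left sum.reindex[OF inj])
  also have "\<dots> \<le> (\<Sum>e\<in>E. \<bar>c e\<bar> * (1 - C e y0))"
  proof (intro sum_mono mult_left_mono)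
    fix e assume e: "e \<in> E"
    have "C e y0 + (\<Sum>y\<in>x ` E. C e y) = (\<Sum>y\<in>insert y0 (x ` E). C e y)"
      using \<open>finite E\<close> y0_not by (subst sum.insert) auto
    also have "\<dots> \<le> (\<Sum>y\<in>?Z. C e y)"
      using y0(1) x C_pos[OF e] shD(2) by (intro sum_mono2) (auto intro: less_imp_le)
    finally show "(\<Sum>y\<in>x ` E. C e y) \<le> 1 - C e y0" using C_sum[OF e] by simp
  qed simp
  finally have "(\<Sum>e\<in>E. \<bar>c e\<bar> * C e y0) \<le> 0"
    by (simp add: right_diff_distrib sum_subtractf)
  moreover have nonneg: "0 \<le> \<bar>c e\<bar> * C e y0" if "e \<in> E" for e
    using C_pos[OF that y0(1)] by simp
  ultimately have "(\<Sum>e\<in>E. \<bar>c e\<bar> * C e y0) = 0"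
    by (intro antisym sum_nonneg nonneg)
  from sum_nonneg_0[OF \<open>finite E\<close> nonneg this \<open>e0 \<in> E\<close>]
  show ?thesis using C_pos[OF \<open>e0 \<in> E\<close> y0(1)] by simp
qed

lemma independent_familyI:
  fixes N :: "'i \<Rightarrow> 'a::real_vector"
  assumes "finite I" and zero: "\<And>c e. (\<Sum>e\<in>I. c e *\<^sub>R N e) = 0 \<Longrightarrow> e \<in> I \<Longrightarrow> c e = 0"
  shows "inj_on N I" and "independent (N ` I)"
proof -
  show inj: "inj_on N I"
  proof (rule inj_onI, rule ccontr)
    fix e e' assume e: "e \<in> I" "e' \<in> I" "N e = N e'" "e \<noteq> e'"
    let ?c = "\<lambda>d. (if d = e then 1 else 0) - (if d = e' then 1 else (0::real))"
    have "(\<Sum>d\<in>I. ?c d *\<^sub>R N d) = (\<Sum>d\<in>I. if d = e then N d else 0) - (\<Sum>d\<in>I. if d = e' then N d else 0)"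
      unfolding sum_subtractf[symmetric] by (intro sum.cong) (auto simp: scaleR_left_diff_distrib)
    also have "\<dots> = 0" using e \<open>finite I\<close> by simp
    finally have "?c e = 0" using zero[of ?c] e(1) by blast
    then show False using e(4) by simp
  qed
  show "independent (N ` I)"
  proof (rule independent_if_scalars_zero)
    fix f y assume "(\<Sum>y\<in>N ` I. f y *\<^sub>R y) = 0" "y \<in> N ` I"
    then show "f y = 0" using zero[of "\<lambda>e. f (N e)"] by (auto simp: sum.reindex[OF inj])
  qed (use \<open>finite I\<close> in simp)
qed

lemma has_derivative_imp_GDERIV:
  fixes f :: "'a::euclidean_space \<Rightarrow> real"
  assumes "(f has_derivative D) (at x)"
  shows "GDERIV f x :> adjoint D 1" and "\<And>v. v \<bullet> adjoint D 1 = D v"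
proof -
  show eq: "v \<bullet> adjoint D 1 = D v" for v
    using adjoint_works[OF has_derivative_linear[OF assms], of v 1] by simp
  show "GDERIV f x :> adjoint D 1"
    using assms by (simp add: gderiv_def eq)
qed

lemma smooth_on_diff:
  fixes f g :: "'a::real_normed_vector \<Rightarrow> real"
  assumes "open S" and "smooth_on S f" and "smooth_on S g"
  shows "smooth_on S (\<lambda>x. f x - g x)"
proof -
  have "higher_differentiable_on S (\<lambda>x. f x + (- 1) * g x) m" for m
    using assms(2,3) unfolding smooth_on_def
    by (intro higher_differentiable_on_add higher_differentiable_on_mult higher_differentiable_on_const \<open>open S\<close>)
      auto
  then show ?thesis by (simp add: smooth_on_def)
qed

section \<open>Equalities between roots and roots of derivatives\<close>

text \<open>
  The differential of \<^term>\<open>equality_fun idx (i, k, j)\<close> at a point \<open>a\<close> where the equality holds. Both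
  roots being equal there, the formula evaluates everything at the single point \<open>x\<^sub>i\<close>.
\<close>
definition relative_velocity :: "(nat \<Rightarrow> 'n) \<Rightarrow> real ^ 'n \<Rightarrow> nat \<times> nat \<times> nat \<Rightarrow> real ^ 'n \<Rightarrow> real" where
  "relative_velocity idx a = (\<lambda>(i, k, j) v. let x = xroot idx 0 i a in
     poly (tail_poly idx v) x / poly (pderiv (monic_poly idx a)) x
     - poly ((pderiv ^^ k) (tail_poly idx v)) x / poly ((pderiv ^^ Suc k) (monic_poly idx a)) x)"

lemma equality_fun_has_derivative:
  fixes idx :: "nat \<Rightarrow> 'n::finite"
  assumes bij: "bij_betw idx {1..CARD('n)} UNIV" and a: "a \<in> interior (hyperbolicity_domain idx)"
    and "e \<in> equalities_at idx a"
  shows "(equality_fun idx e has_derivative relative_velocity idx a e) (at a)"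
proof -
  obtain i k j where e: "e = (i, k, j)" "i \<in> {1..CARD('n) - 0}" "k \<le> CARD('n)" "j \<in> {1..CARD('n) - k}"
    and eq: "xroot idx k j a = xroot idx 0 i a"
    using assms(3) by (auto simp: equalities_at_def)
  show ?thesis
    using has_derivative_diff[OF xroot_has_derivative[OF bij e(3,4) a] xroot_has_derivative[OF bij _ e(2) a]]
    by (simp add: e(1) equality_fun_def relative_velocity_def Let_def eq)
qed

lemma equality_fun_smooth_on:
  fixes idx :: "nat \<Rightarrow> 'n::finite"
  assumes bij: "bij_betw idx {1..CARD('n)} UNIV" and "e \<in> equalities_at idx a"
  shows "smooth_on (interior (hyperbolicity_domain idx)) (equality_fun idx e)"
proof -
  obtain i k j where e: "e = (i, k, j)" "i \<in> {1..CARD('n) - 0}" "k \<le> CARD('n)" "j \<in> {1..CARD('n) - k}"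
    using assms(2) by (auto simp: equalities_at_def)
  show ?thesis
    using smooth_on_diff[OF open_interior xroot_smooth_on[OF bij e(3,4)] xroot_smooth_on[OF bij _ e(2)]]
    by (simp add: e(1) equality_fun_def)
qed

text \<open>
  Pairing a combination of gradients with the coefficient vector of \<open>V\<close> gives the combination of the
  relative velocities in direction \<open>V\<close>. Distinct indices \<open>i\<close> belong to distinct roots, as all roots
  are simple.
\<close>
lemma equality_gradients_independent:
  fixes idx :: "nat \<Rightarrow> 'n::finite"
  assumes bij: "bij_betw idx {1..CARD('n)} UNIV" and a: "a \<in> interior (hyperbolicity_domain idx)"
    and "finite E" and E: "E \<subseteq> equalities_at idx a" and inj: "inj_on fst E"
    and zero: "(\<Sum>e\<in>E. c e *\<^sub>R adjoint (relative_velocity idx a e) 1) = 0" and "e \<in> E"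
  shows "c e = 0"
proof (rule relative_velocities_independent[where p = "monic_poly idx a" and E = E
      and x = "\<lambda>e. xroot idx 0 (fst e) a" and k = "\<lambda>e. fst (snd e)"])
  let ?p = "monic_poly idx a"
  show sh: "strictly_hyperbolic ?p" by (rule strictly_hyperbolic_interior[OF bij a])
  show "poly ?p (xroot idx 0 (fst e) a) = 0 \<and> poly ((pderiv ^^ fst (snd e)) ?p) (xroot idx 0 (fst e) a) = 0
      \<and> 0 < fst (snd e) \<and> fst (snd e) < degree ?p" if eE: "e \<in> E" for e
  proof -
    obtain i k j where e: "e = (i, k, j)" "i \<in> {1..CARD('n) - 0}" "k \<in> {1..CARD('n) - 1}" "j \<in> {1..CARD('n) - k}"
      and eq: "xroot idx k j a = xroot idx 0 i a"
      using subsetD[OF E eE] by (auto simp: equalities_at_def)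
    have "0 < CARD('n)" by simp
    then have k: "0 < k" "k < CARD('n)" using e(3) by auto
    show ?thesis
      using poly_xroot[OF bij a _ e(2)] poly_xroot[OF bij a _ e(4)] k eq e(1)
      by (simp add: degree_monic_poly)
  qed
  show "inj_on (\<lambda>e. xroot idx 0 (fst e) a) E"
  proof (rule inj_onI)
    fix e e' assume e: "e \<in> E" "e' \<in> E" and eq: "xroot idx 0 (fst e) a = xroot idx 0 (fst e') a"
    have "fst e \<in> {1..degree ?p}" "fst e' \<in> {1..degree ?p}"
      using e E unfolding degree_monic_poly equalities_at_def by auto
    then have "fst e = fst e'"
      using eq inj_onD[OF strict_mono_on_imp_inj_on[OF strictly_hyperbolic_ordered_root(2)[OF sh]]]
      by (simp add: xroot_def)
    then show "e = e'" using inj_onD[OF inj] e by blast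
  qed
  fix V :: "real poly" assume "degree V < degree ?p"
  then obtain v where v: "tail_poly idx v = V"
    using tail_poly_surj[OF bij] unfolding degree_monic_poly by blast
  have "(\<Sum>e\<in>E. c e * relative_velocity idx a e v) = v \<bullet> (\<Sum>e\<in>E. c e *\<^sub>R adjoint (relative_velocity idx a e) 1)"
    unfolding inner_sum_right inner_scaleR_right
    using has_derivative_imp_GDERIV(2)[OF equality_fun_has_derivative[OF bij a]] E
    by (intro sum.cong) auto
  then show "(\<Sum>e\<in>E. c e * (poly V (xroot idx 0 (fst e) a) / poly (pderiv ?p) (xroot idx 0 (fst e) a)
      - poly ((pderiv ^^ fst (snd e)) V) (xroot idx 0 (fst e) a) /
        poly ((pderiv ^^ Suc (fst (snd e))) ?p) (xroot idx 0 (fst e) a))) = 0"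
    unfolding zero by (simp add: relative_velocity_def case_prod_unfold Let_def v)
qed (use assms in auto)

theorem proposition11:
  fixes idx :: "nat \<Rightarrow> 'n::finite" and G :: "real ^ 'n" and s :: nat
  assumes "bij_betw idx {1..CARD('n)} UNIV"
    and "G \<in> interior (hyperbolicity_domain idx)"
    and "card (equalities_at idx G) = s"
    and "card (fst ` equalities_at idx G) = s"
    and "card (snd ` equalities_at idx G) = s"
  shows "\<exists>U. open U \<and> G \<in> U \<and> U \<subseteq> hyperbolicity_domain idx \<and>
    (\<forall>e \<in> equalities_at idx G.
       defining_equation U (equality_fun idx e) {a \<in> U. equality_fun idx e a = 0} \<and>
       smooth_hypersurface {a \<in> U. equality_fun idx e a = 0}) \<and>
    intersect_transversally_at G (equalities_at idx G) (\<lambda>e. {a \<in> U. equality_fun idx e a = 0})"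
proof (intro exI[of _ "interior (hyperbolicity_domain idx)"] conjI ballI)
  let ?U = "interior (hyperbolicity_domain idx)" and ?E = "equalities_at idx G"
  let ?H = "\<lambda>e. {a \<in> ?U. equality_fun idx e a = 0}"
  let ?N = "\<lambda>a e. adjoint (relative_velocity idx a e) 1"
  note bij = assms(1) and G = assms(2)
  have grad: "GDERIV (equality_fun idx e) a :> ?N a e" if "a \<in> ?U" "e \<in> equalities_at idx a" for a e
    by (rule has_derivative_imp_GDERIV(1)[OF equality_fun_has_derivative[OF bij that]])
  have def_eq: "defining_equation ?U (equality_fun idx e) (?H e)" if e: "e \<in> ?E" for e
    unfolding defining_equation_def
  proof (intro conjI ballI)
    show "smooth_on ?U (equality_fun idx e)" by (rule equality_fun_smooth_on[OF bij e])
    fix a assume a: "a \<in> ?H e \<inter> ?U"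
    have ea: "e \<in> equalities_at idx a"
      using e a by (auto simp: equalities_at_def equality_fun_def)
    have "?N a e \<noteq> 0"
      using equality_gradients_independent[OF bij, of a "{e}" "\<lambda>_. 1" e] a ea by auto
    then show "\<exists>N. N \<noteq> 0 \<and> (GDERIV (equality_fun idx e) a :> N)" using grad ea a by blast
  qed auto
  show "open ?U" "G \<in> ?U" "?U \<subseteq> hyperbolicity_domain idx"
    using G interior_subset by auto
  show "defining_equation ?U (equality_fun idx e) (?H e)" if "e \<in> ?E" for e
    by (rule def_eq[OF that])
  show "smooth_hypersurface (?H e)" if "e \<in> ?E" for e
    using def_eq[OF that] by (auto simp: smooth_hypersurface_def)
  have fin: "finite ?E"
    by (rule finite_subset[of _ "{1..CARD('n)} \<times> {1..CARD('n) - 1} \<times> {1..CARD('n)}"])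
      (auto simp: equalities_at_def)
  have inj: "inj_on fst ?E"
    by (rule eq_card_imp_inj_on[OF fin]) (use assms in simp)
  have "G \<in> ?H e" if "e \<in> ?E" for e
    using that G by (auto simp: equalities_at_def equality_fun_def)
  moreover have "inj_on (?N G) ?E" "independent (?N G ` ?E)"
    using equality_gradients_independent[OF bij G fin subset_refl inj]
    by (auto intro!: independent_familyI[OF fin])
  ultimately show "intersect_transversally_at G ?E ?H"
    unfolding intersect_transversally_at_def
    using def_eq grad G
    by (intro exI[of _ ?U] exI[of _ "equality_fun idx"] exI[of _ "?N G"]) auto
qed

end
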